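(* Let $T$ be a tree on $n$ vertices which is not a path. Then $\kappa(T)=\min\{n,\kappa^{\ast}(T)\}$. In particular, if $T$ is not of the form $S^{3}(l_{1},l_{2},l_{3})$, then $\kappa(T)=\kappa^{\ast}(T)$.
   Context: All graphs are finite, simple and connected; $d(u,v)$ is the shortest-path distance. For vertices $x,y,s$ put $\Delta_s(x,y)=|d(x,s)-d(y,s)|$ and for $S\subseteq V(G)$ put $\Delta_S(x,y)=\sum_{s\in S}\Delta_s(x,y)$. For an integer $k\ge 1$, a set $S\subseteq V(G)$ is a weak $k$-resolving set of $G$ if $\Delta_S(x,y)\ge k$ for every pair of distinct vertices $x,y\in V(G)$. $\kappa(G)$ denotes the largest integer $k$ such that $G$ has a weak $k$-resolving set. In a tree $T$, for a vertex $v$ of degree at least $3$, a thread of length $l$ hanging at $v$ is a path $vv_1\cdots v_l$ in $T$ with $\deg(v_i)=2$ for $1\le i\le l-1$ and $\deg(v_l)=1$. A vertex $v$ of degree at least 3 at which at least two threads hang is a root vertex; the number $\ell(v)\ge 2$ of threads hanging at it is its root degree, and $l_1(v)\le l_2(v)\le\cdots\le l_{\ell(v)}(v)$ are the lengths of these threads. $R(T)$ is the set of root vertices, and $\kappa^{\ast}(T)=\min\{2(l_1(v)+l_2(v)) : v\in R(T)\}$. $S^{3}(l_1,l_2,l_3)$ denotes a tree with exactly one root vertex, of root degree $3$, with thread lengths $l_1\le l_2\le l_3$ (i.e. a tree obtained from the star $K_{1,3}$ by subdividing its edges). *)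

theory Defs
  imports "Graph_Theory.Graph_Theory" "HOL-Library.Multiset"
begin

text \<open>
  A finite simple graph is a digraph in the locale \<^locale>\<open>graph\<close> (finite, loop-free, no parallel
  arcs, symmetric): each undirected edge is a pair of opposite arcs. In such a graph
  \<^const>\<open>out_degree\<close> is the usual vertex degree.
\<close>

text \<open>
  The library's \<open>tree\<close> cannot be used here: for it the two opposite arcs of an edge already form
  a cycle. A cycle of the undirected graph is a directed cycle of length at least 3.
\<close>

definition is_tree :: "('a, 'b) pre_digraph \<Rightarrow> bool" where
  "is_tree G \<longleftrightarrow> graph G \<and> connected G \<and> \<not> (\<exists>p. pre_digraph.cycle G p \<and> length p \<ge> 3)"

definition is_path_graph :: "('a, 'b) pre_digraph \<Rightarrow> bool" where
  "is_path_graph G \<longleftrightarrow> graph G \<and>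
     (\<exists>p. vpath p G \<and> set p = verts G \<and>
          arcs_ends G = set (vwalk_arcs p) \<union> (set (vwalk_arcs p))\<inverse>)"

definition gdist :: "('a, 'b) pre_digraph \<Rightarrow> 'a \<Rightarrow> 'a \<Rightarrow> nat" where
  "gdist G u v = (LEAST n. \<exists>p. pre_digraph.awalk G u p v \<and> length p = n)"

lemma gdist_eq_\<mu>:
  assumes "wf_digraph G" "u \<rightarrow>\<^sup>*\<^bsub>G\<^esub> v"
  shows "wf_digraph.\<mu> G (\<lambda>_. 1) u v = ereal (real (gdist G u v))"
proof -
  interpret wf_digraph G by fact
  obtain p where "awalk u p v" using assms(2) reachable_awalk by auto
  then have ex: "\<exists>n p. awalk u p v \<and> length p = n" by blast
  obtain q where q: "awalk u q v" "length q = gdist G u v"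
    using LeastI_ex[OF ex] unfolding gdist_def by blast
  have le: "gdist G u v \<le> length p" if "awalk u p v" for p
    unfolding gdist_def using that by (intro Least_le) blast
  have cost: "awalk_cost (\<lambda>_. 1) p = real (length p)" for p :: "'b list"
    by (simp add: awalk_cost_def sum_list_triv)
  show ?thesis
    unfolding \<mu>_def cost
  proof (rule antisym)
    show "(INF p\<in>{p. awalk u p v}. ereal (real (length p))) \<le> ereal (real (gdist G u v))"
      using q by (intro INF_lower2[of q]) auto
    show "ereal (real (gdist G u v)) \<le> (INF p\<in>{p. awalk u p v}. ereal (real (length p)))"
      using le by (intro INF_greatest) auto
  qed
qed

definition Delta_vertex :: "('a, 'b) pre_digraph \<Rightarrow> 'a \<Rightarrow> 'a \<Rightarrow> 'a \<Rightarrow> nat" where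
  "Delta_vertex G s x y = nat \<bar>int (gdist G x s) - int (gdist G y s)\<bar>"

definition Delta_set :: "('a, 'b) pre_digraph \<Rightarrow> 'a set \<Rightarrow> 'a \<Rightarrow> 'a \<Rightarrow> nat" where
  "Delta_set G S x y = (\<Sum>s\<in>S. Delta_vertex G s x y)"

definition weak_resolving_set :: "('a, 'b) pre_digraph \<Rightarrow> nat \<Rightarrow> 'a set \<Rightarrow> bool" where
  "weak_resolving_set G k S \<longleftrightarrow> S \<subseteq> verts G \<and>
     (\<forall>x\<in>verts G. \<forall>y\<in>verts G. x \<noteq> y \<longrightarrow> Delta_set G S x y \<ge> k)"

text \<open>
  Meaningful for graphs with at least two vertices; on a single vertex every \<open>k\<close> qualifies and
  there is no largest one.
\<close>

definition kappa :: "('a, 'b) pre_digraph \<Rightarrow> nat" where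
  "kappa G = (GREATEST k. k \<ge> 1 \<and> (\<exists>S. weak_resolving_set G k S))"

text \<open>A thread \<open>v v\<^sub>1 \<dots> v\<^sub>l\<close> hanging at \<open>v\<close> is represented by the list \<open>[v\<^sub>1, \<dots>, v\<^sub>l]\<close>, so
  that its length as a list is the length of the thread.\<close>

definition threads :: "('a, 'b) pre_digraph \<Rightarrow> 'a \<Rightarrow> 'a list set" where
  "threads G v = {vs. vs \<noteq> [] \<and> vpath (v # vs) G \<and>
     (\<forall>u\<in>set (butlast vs). out_degree G u = 2) \<and> out_degree G (last vs) = 1}"

definition root_degree :: "('a, 'b) pre_digraph \<Rightarrow> 'a \<Rightarrow> nat" where
  "root_degree G v = card (threads G v)"

definition root_vertices :: "('a, 'b) pre_digraph \<Rightarrow> 'a set" where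
  "root_vertices G = {v \<in> verts G. out_degree G v \<ge> 3 \<and> root_degree G v \<ge> 2}"

text \<open>The lengths of the threads at \<open>v\<close>, with multiplicity and in increasing order; list indices
  start at 0, so \<open>l\<^sub>i(v)\<close> is \<open>thread_lengths G v ! (i - 1)\<close>.\<close>

definition thread_lengths :: "('a, 'b) pre_digraph \<Rightarrow> 'a \<Rightarrow> nat list" where
  "thread_lengths G v = sorted_list_of_multiset (image_mset length (mset_set (threads G v)))"

definition kappa_star :: "('a, 'b) pre_digraph \<Rightarrow> nat" where
  "kappa_star G = Min {2 * (thread_lengths G v ! 0 + thread_lengths G v ! 1) | v. v \<in> root_vertices G}"

definition is_S3 :: "('a, 'b) pre_digraph \<Rightarrow> nat \<Rightarrow> nat \<Rightarrow> nat \<Rightarrow> bool" where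
  "is_S3 G l1 l2 l3 \<longleftrightarrow> is_tree G \<and>
     (\<exists>v. root_vertices G = {v} \<and> root_degree G v = 3 \<and> thread_lengths G v = [l1, l2, l3])"

end

theory Submission
  imports Defs
begin

text \<open>
  Enlarging a set never decreases \<open>\<Delta>\<close>, so \<open>\<kappa>(T)\<close> is the minimum of \<open>\<Delta>\<^sub>V(x, y)\<close> over \<open>x \<noteq> y\<close>.
  Adjacent vertices give \<open>n\<close>, and the first vertices of two threads at a root give twice the sum
  of the two lengths. Conversely, if \<open>d(x, y)\<close> is odd, every vertex contributes at least 1 by
  bipartiteness. If it is even, let \<open>c\<close> be the midpoint: each vertex of the two branches at \<open>c\<close>
  containing \<open>x\<close> and \<open>y\<close> contributes at least 2. A branch either is a thread at \<open>c\<close> or contains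
  two threads of a root vertex lying in it, so (as \<open>T\<close> is not a path) the two branches together
  have at least as many vertices as some two threads hanging at a common root.

  If \<open>T\<close> is not of the form \<open>S\<^sup>3\<close>, it has two roots or a single root with at least four threads;
  in either case four pairwise disjoint threads show \<open>\<kappa>\<^sup>* \<le> n\<close>.
\<close>

section \<open>Reversing walks, and the two least values of a finite family\<close>

text \<open>Each arc is replaced by its opposite. Keeping the length serves the symmetry of
  distances; keeping the vertex set lets a reversed walk go on avoiding a given vertex.\<close>

lemma (in sym_digraph) awalk_reverse:
  assumes "awalk u p v"
  obtains q where "awalk v q u" "length q = length p"
    "set (awalk_verts v q) = set (awalk_verts u p)"
proof -
  have "\<exists>q. awalk v q u \<and> length q = length p \<and> set (awalk_verts v q) = set (awalk_verts u p)"
    using assms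
  proof (induction p arbitrary: u)
    case Nil
    then show ?case by (auto simp: awalk_Nil_iff intro!: exI[of _ "[]"])
  next
    case (Cons e es)
    then have e: "e \<in> arcs G" "u = tail G e" "awalk (head G e) es v" by (auto simp: awalk_Cons_iff)
    from Cons.IH[OF e(3)] obtain q where q: "awalk v q (head G e)" "length q = length es"
      "set (awalk_verts v q) = set (awalk_verts (head G e) es)" by blast
    obtain e' where e': "e' \<in> arcs G" "tail G e' = head G e" "head G e' = tail G e"
      using sym_arcs e(1) unfolding symmetric_conv by metis
    have *: "awalk (head G e) [e'] u"
      using e e' by (simp add: awalk_simps)
    have "awalk v (q @ [e']) u" using q(1) * by (rule awalk_appendI)
    moreover have "set (awalk_verts v (q @ [e'])) = set (awalk_verts u (e # es))"
      unfolding set_awalk_verts_append[OF q(1) *] using q(1,3) e' e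
      by (auto simp: hd_in_awalk_verts(1))
    ultimately show ?case using q(2) by (intro exI[of _ "q @ [e']"]) auto
  qed
  then show ?thesis using that by blast
qed

text \<open>The elements are sorted by \<open>f\<close>, not just their values, so that the first
  two entries stay tied to different elements even when their values coincide.
  \<open>thread_lengths\<close> is the instance with \<open>f = length\<close>.\<close>

lemma sorted_image_two_least:
  fixes f :: "'a \<Rightarrow> nat"
  assumes F: "finite F" "card F \<ge> 2"
  defines "xs \<equiv> sorted_list_of_multiset (image_mset f (mset_set F))"
  shows "\<exists>p\<in>F. \<exists>q\<in>F. p \<noteq> q \<and> xs ! 0 = f p \<and> xs ! 1 = f q"
    and "\<And>p q. p \<in> F \<Longrightarrow> q \<in> F \<Longrightarrow> p \<noteq> q \<Longrightarrow> xs ! 0 + xs ! 1 \<le> f p + f q"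
proof -
  obtain qs where qs: "set qs = F" "distinct qs" using finite_distinct_list F(1) by blast
  define ps where "ps = sort_key f qs"
  have ps: "set ps = F" "distinct ps" "sorted (map f ps)" using qs by (auto simp: ps_def)
  have "image_mset f (mset_set F) = mset (map f ps)" using ps by (metis mset_map mset_set_set)
  then have xs: "xs = map f ps" using ps(3) by (simp add: xs_def sorted_sort_id del: mset_map)
  have len: "length ps \<ge> 2" using F(2) distinct_card[OF ps(2)] ps(1) by simp
  have mono: "i \<le> j \<Longrightarrow> j < length ps \<Longrightarrow> f (ps ! i) \<le> f (ps ! j)" for i j
    using sorted_nth_mono[OF ps(3), of i j] by simp
  have "ps ! 0 \<in> F" "ps ! 1 \<in> F" "ps ! 0 \<noteq> ps ! 1"
    using nth_mem[of 0 ps] nth_mem[of 1 ps] nth_eq_iff_index_eq[OF ps(2), of 0 1] len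
    unfolding ps(1) by linarith+
  moreover have xs01: "xs ! 0 = f (ps ! 0)" "xs ! 1 = f (ps ! 1)"
    unfolding xs by (rule nth_map, use len in linarith)+
  ultimately show "\<exists>p\<in>F. \<exists>q\<in>F. p \<noteq> q \<and> xs ! 0 = f p \<and> xs ! 1 = f q"
    by blast
  fix p q assume "p \<in> F" "q \<in> F" "p \<noteq> q"
  then obtain i j where ij: "i < length ps" "p = ps ! i" "j < length ps" "q = ps ! j" "i \<noteq> j"
    using ps(1) by (metis in_set_conv_nth)
  \<comment> \<open>Of two different indices one is at least 1; its value dominates entry 1, the
    other value dominates entry 0.\<close>
  then consider "1 \<le> j" | "1 \<le> i" by linarith
  then show "xs ! 0 + xs ! 1 \<le> f p + f q"
  proof cases
    case 1
    then show ?thesis using add_mono[OF mono[of 0 i] mono[of 1 j]] ij len unfolding xs01 by simp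
  next
    case 2
    then show ?thesis using add_mono[OF mono[of 0 j] mono[of 1 i]] ij len unfolding xs01 by simp
  qed
qed

section \<open>Neighbours and distances in a tree\<close>

locale tree_graph = graph +
  assumes conn: "connected G"
    and acyclic: "cycle p \<Longrightarrow> length p < 3"
begin

abbreviation "d \<equiv> gdist G"

definition "nb u = {w. u \<rightarrow> w}"

text \<open>For \<open>a\<close> adjacent to \<open>c\<close> this is the component of the tree
  minus \<open>c\<close> that contains \<open>a\<close>, described by distances so that no vertex
  has to be deleted.\<close>

definition "branch c a = {s \<in> verts G. d a s < d c s}"

lemma adj_sym: "u \<rightarrow> v \<Longrightarrow> v \<rightarrow> u"
  using sym_arcs by (rule arcs_ends_symmetric)

lemma nb_verts: "a \<in> nb c \<Longrightarrow> a \<in> verts G" "a \<in> nb c \<Longrightarrow> c \<in> verts G"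
  by (auto simp: nb_def adj_in_verts)

lemma nb_sym: "a \<in> nb c \<Longrightarrow> c \<in> nb a"
  by (auto simp: nb_def adj_sym)

lemma nb_irrefl: "a \<in> nb c \<Longrightarrow> a \<noteq> c"
  using adj_not_same by (auto simp: nb_def)

lemma finite_nb: "finite (nb c)"
  by (rule finite_subset[of _ "verts G"]) (auto simp: nb_verts)

lemma out_degree_nb: "out_degree G u = card (nb u)"
proof -
  have "bij_betw (head G) (out_arcs G u) (nb u)"
    unfolding bij_betw_def inj_on_def nb_def out_arcs_def arcs_ends_conv
    using no_multi_arcs by (auto simp: arc_to_ends_def)
  then show ?thesis
    unfolding out_degree_def by (rule bij_betw_same_card)
qed

lemma ex_awalk:
  assumes "u \<in> verts G" "v \<in> verts G" shows "\<exists>p. awalk u p v"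
proof -
  have "u \<rightarrow>\<^sup>* v"
    using conn assms sym_arcs unfolding connected_def strongly_connected_def
    by (simp add: reachable_mk_symmetric_eq)
  then show ?thesis by (simp add: reachable_awalk)
qed

text \<open>Connectedness makes the set under \<open>LEAST\<close> nonempty. Off the vertex set
  there are no walks and \<open>gdist\<close> carries no information, hence the membership
  hypotheses on distances.\<close>

lemma geodesic:
  assumes "u \<in> verts G" "v \<in> verts G" obtains p where "awalk u p v" "length p = d u v"
proof -
  have "\<exists>n p. awalk u p v \<and> length p = n" using ex_awalk[OF assms] by blast
  from LeastI_ex[OF this] show ?thesis using that unfolding gdist_def by blast
qed

lemma dist_le: "awalk u p v \<Longrightarrow> d u v \<le> length p"
  unfolding gdist_def by (intro Least_le) blast

lemma dist_self [simp]: "u \<in> verts G \<Longrightarrow> d u u = 0"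
  using dist_le[of u "[]" u] by (simp add: awalk_Nil_iff)

lemma dist_0_iff: "u \<in> verts G \<Longrightarrow> v \<in> verts G \<Longrightarrow> d u v = 0 \<longleftrightarrow> u = v"
  by (metis geodesic length_0_conv awalk_empty_ends dist_self)

lemma dist_sym: assumes "u \<in> verts G" "v \<in> verts G" shows "d u v = d v u"
proof -
  have "d a b \<le> d b a" if ab: "a \<in> verts G" "b \<in> verts G" for a b
    by (metis ab geodesic awalk_reverse dist_le)
  then show ?thesis using assms by (simp add: order_antisym)
qed

lemma dist_triangle:
  assumes "u \<in> verts G" "v \<in> verts G" "w \<in> verts G" shows "d u w \<le> d u v + d v w"
proof -
  obtain p where p: "awalk u p v" "length p = d u v" using assms geodesic by blast
  obtain q where q: "awalk v q w" "length q = d v w" using assms geodesic by blast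
  show ?thesis using dist_le[OF awalk_appendI[OF p(1) q(1)]] p q by simp
qed

lemma dist_nb: assumes "a \<in> nb c" shows "d c a = 1"
proof -
  obtain e where e: "e \<in> arcs G" "tail G e = c" "head G e = a"
    using assms by (auto simp: nb_def)
  then have "d c a \<le> 1" using dist_le[of c "[e]" a] by (auto simp: awalk_simps)
  moreover have "d c a \<noteq> 0" using assms dist_0_iff nb_verts nb_irrefl by metis
  ultimately show ?thesis by simp
qed

lemma dist_nb_le: "a \<in> nb c \<Longrightarrow> s \<in> verts G \<Longrightarrow> d a s \<le> d c s + 1"
  using dist_triangle[of a c s] dist_nb[OF nb_sym] nb_verts by fastforce

lemma ex_closer_nb:
  assumes "u \<in> verts G" "v \<in> verts G" "u \<noteq> v"
  obtains w where "w \<in> nb u" "d u v = d w v + 1"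
proof -
  obtain p where p: "awalk u p v" "length p = d u v" using assms geodesic by blast
  then obtain e es where "p = e # es" using assms by (cases p) (auto simp: awalk_Nil_iff)
  with p have e: "e \<in> arcs G" "u = tail G e" "awalk (head G e) es v" by (auto simp: awalk_Cons_iff)
  have n: "head G e \<in> nb u" using e in_arcs_imp_in_arcs_ends by (auto simp: nb_def)
  have "d (head G e) v + 1 \<le> d u v" using dist_le[OF e(3)] p \<open>p = e # es\<close> by simp
  moreover have "d u v \<le> d (head G e) v + 1" using dist_nb_le[OF nb_sym[OF n]] assms by blast
  ultimately show ?thesis using that n by force
qed

section \<open>Acyclicity in metric form\<close>

lemma geodesic_avoids:
  assumes "a \<in> nb c" "s \<in> verts G" "d a s \<le> d c s"
  obtains p where "awalk a p s" "c \<notin> set (awalk_verts a p)"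
proof -
  obtain p where p: "awalk a p s" "length p = d a s" using assms nb_verts geodesic by blast
  \<comment> \<open>A geodesic through \<open>c\<close> would have length at least
    \<open>d a c + d c s\<close>, that is \<open>1 + d c s\<close>.\<close>
  have "c \<notin> set (awalk_verts a p)"
  proof
    assume "c \<in> set (awalk_verts a p)"
    then obtain q r where qr: "p = q @ r" "awalk a q c" "awalk c r s"
      using awalk_decomp p(1) by blast
    then have "d a c + d c s \<le> d a s"
      using dist_le[OF qr(2)] dist_le[OF qr(3)] p(2) by simp
    then show False using assms dist_nb[OF nb_sym] by fastforce
  qed
  then show ?thesis using that p by blast
qed

text \<open>Two walks from neighbours of \<open>c\<close> to \<open>s\<close> that both avoid \<open>c\<close> would close up to a cycle
  through \<open>c\<close>. This is the only use of acyclicity.\<close>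

lemma no_two_descents:
  assumes a: "a \<in> nb c" and b: "b \<in> nb c" and ab: "a \<noteq> b" and s: "s \<in> verts G"
    and le: "d a s \<le> d c s" "d b s \<le> d c s"
  shows False
proof -
  obtain p where p: "awalk a p s" "c \<notin> set (awalk_verts a p)" using geodesic_avoids a s le by blast
  obtain q where q: "awalk b q s" "c \<notin> set (awalk_verts b q)" using geodesic_avoids b s le by blast
  obtain q' where q': "awalk s q' b" "set (awalk_verts s q') = set (awalk_verts b q)"
    using awalk_reverse[OF q(1)] by blast
  let ?w = "p @ q'"
  have w: "awalk a ?w b" using p(1) q'(1) by (rule awalk_appendI)
  have cw: "c \<notin> set (awalk_verts a ?w)"
    unfolding set_awalk_verts_append[OF p(1) q'(1)] using p q q' by simp
  define r where "r = awalk_to_apath ?w"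
  have r: "apath a r b" unfolding r_def using w by (rule apath_awalk_to_apath)
  have rw: "awalk a r b" "distinct (awalk_verts a r)" using r by (auto simp: apath_def)
  \<comment> \<open>Shortening the walk to a path introduces no new arcs, so \<open>r\<close> still
    avoids \<open>c\<close>.\<close>
  have "set r \<subseteq> set ?w" unfolding r_def using w by (rule awalk_to_apath_subset)
  then have cr: "c \<notin> set (awalk_verts a r)"
    using cw set_awalk_verts[OF w] set_awalk_verts[OF rw(1)] by auto
  have rne: "r \<noteq> []" using rw(1) ab by (auto simp: awalk_Nil_iff)
  obtain e where e: "e \<in> arcs G" "tail G e = c" "head G e = a" using a by (auto simp: nb_def)
  obtain f where f: "f \<in> arcs G" "tail G f = b" "head G f = c"
    using nb_sym[OF b] by (auto simp: nb_def)
  have ra: "awalk a (r @ [f]) c" using rw(1) f by (auto simp: awalk_simps)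
  have "awalk c (e # r @ [f]) c" using ra e by (auto simp: awalk_Cons_iff)
  moreover have "awalk_verts a (r @ [f]) = awalk_verts a r @ [c]"
    using awalk_verts_append[OF ra] f rw(1) by simp
  ultimately have "cycle (e # r @ [f])"
    unfolding cycle_def using e rw(2) cr by (intro exI[of _ c]) simp
  \<comment> \<open>As \<open>a\<close> and \<open>b\<close> differ, \<open>r\<close> has at least
    one arc, so the cycle has at least three.\<close>
  from acyclic[OF this] rne show False by (cases r) auto
qed

text \<open>This is bipartiteness. In case of equality, \<open>a\<close> and the first vertex of a
  geodesic from \<open>c\<close> to \<open>s\<close> would be two different descents.\<close>

lemma dist_nb_neq:
  assumes a: "a \<in> nb c" and s: "s \<in> verts G" shows "d a s \<noteq> d c s"
proof
  assume eq: "d a s = d c s"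
  have "c \<noteq> s" using eq a s dist_0_iff nb_verts nb_irrefl by (metis dist_self)
  then obtain b where "b \<in> nb c" "d c s = d b s + 1" using ex_closer_nb nb_verts a s by metis
  then show False using no_two_descents[OF a, of b s] eq s by (cases "a = b") auto
qed

section \<open>Branches at a vertex\<close>

lemma dist_in_branch: assumes "a \<in> nb c" "s \<in> branch c a" shows "d c s = d a s + 1"
  using assms dist_nb_le[OF nb_sym, of a c s] by (auto simp: branch_def)

lemma dist_notin_branch:
  assumes "a \<in> nb c" "s \<in> verts G" "s \<notin> branch c a" shows "d a s = d c s + 1"
  using assms dist_nb_le[of a c s] dist_nb_neq[of a c s] by (auto simp: branch_def)

lemma branch_disjoint:
  "a \<in> nb c \<Longrightarrow> b \<in> nb c \<Longrightarrow> a \<noteq> b \<Longrightarrow> branch c a \<inter> branch c b = {}"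
  using no_two_descents[of a c b] by (force simp: branch_def)

lemma branch_subset: "branch c a \<subseteq> verts G"
  by (auto simp: branch_def)

lemma finite_branch: "finite (branch c a)"
  using branch_subset finite_verts by (rule finite_subset)

lemma root_notin_branch: "c \<notin> branch c a"
  by (auto simp: branch_def)

text \<open>This recursion drives the inductions along threads and over branches: apart from
  \<open>a\<close>, each vertex is sorted by the neighbour of \<open>a\<close> through which it is
  reached.\<close>

lemma branch_decomp:
  assumes a: "a \<in> nb c"
  shows "branch c a = insert a (\<Union>b\<in>nb a - {c}. branch a b)"
proof (intro equalityI subsetI)
  fix s assume s: "s \<in> branch c a"
  then have sv: "s \<in> verts G" by (simp add: branch_def)
  show "s \<in> insert a (\<Union>b\<in>nb a - {c}. branch a b)"
  proof (cases "s = a")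
    case False
    then obtain b where b: "b \<in> nb a" "d a s = d b s + 1" using ex_closer_nb nb_verts a sv by metis
    then have "b \<noteq> c" using s by (auto simp: branch_def)
    then show ?thesis using b sv by (auto simp: branch_def)
  qed simp
next
  fix s assume "s \<in> insert a (\<Union>b\<in>nb a - {c}. branch a b)"
  then show "s \<in> branch c a"
  proof
    assume "s = a"
    then show ?thesis using dist_nb[OF a] nb_verts[OF a] by (simp add: branch_def)
  next
    assume "s \<in> (\<Union>b\<in>nb a - {c}. branch a b)"
    then obtain b where b: "b \<in> nb a" "b \<noteq> c" "s \<in> branch a b" by blast
    \<comment> \<open>Otherwise \<open>b\<close> and \<open>c\<close> would be two descents from
      \<open>a\<close> to \<open>s\<close>.\<close>
    then have "\<not> d c s \<le> d a s"
      using no_two_descents[of b a c s] nb_sym[OF a] by (auto simp: branch_def)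
    then show ?thesis using b by (auto simp: branch_def)
  qed
qed

lemma verts_decomp:
  assumes c: "c \<in> verts G"
  shows "verts G = insert c (\<Union>a\<in>nb c. branch c a)"
proof -
  have "s \<in> (\<Union>a\<in>nb c. branch c a)" if s: "s \<in> verts G" "s \<noteq> c" for s
  proof -
    obtain a where "a \<in> nb c" "d c s = d a s + 1" using ex_closer_nb c s by metis
    then show ?thesis using s by (auto simp: branch_def)
  qed
  then show ?thesis using c branch_subset by blast
qed

lemma branch_psubset:
  assumes "a \<in> nb c" "b \<in> nb a" "b \<noteq> c" shows "branch a b \<subset> branch c a"
  using branch_decomp[OF assms(1)] assms root_notin_branch[of a b] by blast

text \<open>Every route out of the branch passes \<open>c\<close>. One step from \<open>b\<close>
  towards \<open>y\<close> leads to a smaller branch, at \<open>b\<close>, with \<open>s\<close>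
  still outside, so the pair \<open>c\<close>, \<open>b\<close> can move in the induction.\<close>

lemma dist_through_root:
  assumes "b \<in> nb c" "y \<in> branch c b" "s \<in> verts G" "s \<notin> branch c b"
  shows "d y s = d y c + d c s"
  using assms
proof (induction "d b y" arbitrary: b c rule: less_induct)
  case less
  note b = less.prems(1)
  have V: "c \<in> verts G" "b \<in> verts G" "y \<in> verts G" "s \<in> verts G"
    using less.prems nb_verts by (auto simp: branch_def)
  have ds: "d b s = d c s + 1" using dist_notin_branch less.prems by blast
  have dy: "d y c = d y b + 1" using dist_in_branch[OF b less.prems(2)] V dist_sym by metis
  show ?case
  proof (cases "y = b")
    case True
    then show ?thesis using ds dy V by simp
  next
    case False
    then obtain b' where b': "b' \<in> nb b" "d b y = d b' y + 1" using ex_closer_nb V by metis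
    \<comment> \<open>\<open>c\<close> is farther from \<open>y\<close> than \<open>b\<close> is, so
      a step towards \<open>y\<close> does not return to \<open>c\<close>.\<close>
    have "b' \<noteq> c" using b' dist_in_branch[OF b less.prems(2)] by auto
    then have "s \<notin> branch b b'" using branch_psubset[OF b b'(1)] less.prems(4) by blast
    moreover have "y \<in> branch b b'" using b' V by (auto simp: branch_def)
    ultimately have "d y s = d y b + d b s" using less.hyps[of b' b] b' V(4) by auto
    then show ?thesis using ds dy by simp
  qed
qed

section \<open>Parity and points on geodesics\<close>

text \<open>Moving \<open>x\<close> one step towards \<open>y\<close> changes both
  \<open>d x s\<close> and \<open>d x y\<close> by exactly one.\<close>

lemma parity:
  assumes "x \<in> verts G" "y \<in> verts G" "s \<in> verts G"
  shows "even (d x s + d y s + d x y)"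
  using assms
proof (induction "d x y" arbitrary: x)
  case 0
  then show ?case using dist_0_iff[of x y] by simp
next
  case (Suc n)
  then have "x \<noteq> y" by auto
  then obtain w where w: "w \<in> nb x" "d x y = d w y + 1" using ex_closer_nb Suc.prems by metis
  have "d w s = d x s + 1 \<or> d x s = d w s + 1"
    using dist_in_branch[OF w(1)] dist_notin_branch[OF w(1)] Suc.prems by blast
  moreover have "even (d w s + d y s + d w y)" using Suc w nb_verts by auto
  ultimately show ?case using w(2) by fastforce
qed

lemma geodesic_split:
  assumes "x \<in> verts G" "y \<in> verts G" "k \<le> d x y"
  obtains c where "c \<in> verts G" "d x c = k" "d c y = d x y - k"
proof -
  have "\<exists>c\<in>verts G. d x c = k \<and> d c y = d x y - k"
    using assms(3)
  proof (induction k)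
    case 0
    then show ?case using assms by (auto intro!: bexI[of _ x])
  next
    case (Suc k)
    then obtain c where c: "c \<in> verts G" "d x c = k" "d c y = d x y - k" by auto
    then have "c \<noteq> y" using Suc.prems by auto
    then obtain w where w: "w \<in> nb c" "d c y = d w y + 1" using ex_closer_nb c assms by metis
    have wv: "w \<in> verts G" using w nb_verts by blast
    have "d x w \<le> Suc k" using dist_triangle[of x c w] dist_nb[OF w(1)] c wv assms by simp
    moreover have "d x y \<le> d x w + d w y" using dist_triangle wv assms by blast
    ultimately show ?case using w c Suc.prems wv by (intro bexI[of _ w]) auto
  qed
  then show ?thesis using that by blast
qed

section \<open>Threads and the branches they fill\<close>

lemma threads_nb:
  assumes "vs \<in> threads G v" shows "hd vs \<in> nb v" "vs \<noteq> []" "distinct vs" "v \<notin> set vs"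
  using assms by (cases vs; auto simp: threads_def nb_def vpath_def vwalk_def)+

lemma singleton_thread_iff: "[x] \<in> threads G v \<longleftrightarrow> x \<in> nb v \<and> nb x = {v}"
proof
  assume t: "[x] \<in> threads G v"
  then have x: "x \<in> nb v" using threads_nb[OF t] by simp
  moreover have "card (nb x) = 1" using t by (simp add: threads_def out_degree_nb)
  ultimately show "x \<in> nb v \<and> nb x = {v}" using nb_sym[OF x] by (auto simp: card_1_singleton_iff)
next
  assume "x \<in> nb v \<and> nb x = {v}"
  then show "[x] \<in> threads G v"
    using nb_verts[of x v] nb_irrefl[of x v]
    by (auto simp: threads_def out_degree_nb vpath_def vwalk_def nb_def)
qed

text \<open>\<open>threads\<close> puts no degree condition on the vertex at which a thread hangs,
  so the tail of a thread is again a thread. Inductions along a thread rest on this.\<close>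

lemma thread_ConsD:
  assumes "x # ys \<in> threads G v" "ys \<noteq> []"
  shows "x \<in> nb v" "nb x = {v, hd ys}" "v \<noteq> hd ys" "ys \<in> threads G x"
proof -
  show x: "x \<in> nb v" using threads_nb[OF assms(1)] by simp
  show ys: "ys \<in> threads G x"
    using assms by (cases ys) (auto simp: threads_def vpath_def vwalk_def)
  show ne: "v \<noteq> hd ys" using threads_nb(4)[OF assms(1)] assms(2) by (cases ys) auto
  have "card (nb x) = 2" using assms by (auto simp: threads_def out_degree_nb)
  then show "nb x = {v, hd ys}"
    using nb_sym[OF x] threads_nb(1)[OF ys] ne by (auto simp: card_2_iff)
qed

text \<open>By the degree conditions, \<open>branch_decomp\<close> offers at most one continuation
  at each vertex of the thread and none at the last.\<close>

lemma set_thread: "vs \<in> threads G v \<Longrightarrow> set vs = branch v (hd vs)"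
proof (induction vs arbitrary: v)
  case Nil
  then show ?case by (simp add: threads_def)
next
  case (Cons x ys)
  have x: "x \<in> nb v" using threads_nb(1)[OF Cons.prems] by simp
  show ?case
  proof (cases "ys = []")
    case True
    then have "nb x = {v}" using Cons.prems by (simp add: singleton_thread_iff)
    then show ?thesis using True branch_decomp[OF x] by simp
  next
    case False
    note D = thread_ConsD[OF Cons.prems False]
    have "nb x - {v} = {hd ys}" using D by auto
    then show ?thesis using Cons.IH[OF D(4)] branch_decomp[OF x] by simp
  qed
qed

lemma length_thread: "vs \<in> threads G v \<Longrightarrow> length vs = card (branch v (hd vs))"
  using set_thread threads_nb(3) distinct_card by metis

lemma thread_ConsI:
  assumes x: "x \<in> nb v" and nb: "nb x = {v, hd ys}" and ne: "v \<noteq> hd ys" and ys: "ys \<in> threads G x"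
  shows "x # ys \<in> threads G v"
proof -
  have yne: "ys \<noteq> []" using ys by (simp add: threads_def)
  \<comment> \<open>The new list must not revisit \<open>v\<close>: \<open>ys\<close> fills a branch
    lying inside \<open>branch v x\<close>, which does not contain \<open>v\<close>.\<close>
  have "branch x (hd ys) \<subset> branch v x"
    using branch_psubset[OF x] threads_nb(1)[OF ys] ne by blast
  then have "v \<notin> set ys" using set_thread[OF ys] root_notin_branch by blast
  moreover have "out_degree G x = 2" using nb ne by (simp add: out_degree_nb)
  ultimately show ?thesis
    using yne ys x nb_verts[OF x] nb_irrefl[OF x] threads_nb[OF ys]
    by (cases ys) (auto simp: threads_def vpath_def vwalk_def nb_def)
qed

text \<open>After the first vertex there is never a choice. Hence threads at \<open>v\<close> inject
  into the neighbours of \<open>v\<close>.\<close>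

lemma thread_eqI:
  assumes "ps \<in> threads G v" "qs \<in> threads G v" "hd ps = hd qs" shows "ps = qs"
  using assms
proof (induction ps arbitrary: v qs)
  case Nil
  then show ?case by (simp add: threads_def)
next
  case (Cons x ys)
  obtain zs where qs: "qs = x # zs" using Cons.prems threads_nb(2) by (cases qs) fastforce+
  show ?case
  proof (cases "ys = [] \<or> zs = []")
    case True
    then show ?thesis
      using Cons.prems qs singleton_thread_iff[of x v] thread_ConsD[of x ys v] thread_ConsD[of x zs v]
      by fastforce
  next
    case False
    then have D: "nb x = {v, hd ys}" "v \<noteq> hd ys" "ys \<in> threads G x"
      "nb x = {v, hd zs}" "v \<noteq> hd zs" "zs \<in> threads G x"
      using thread_ConsD[of x ys v] thread_ConsD[of x zs v] Cons.prems(1,2) qs by auto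
    then have "hd ys = hd zs" by (metis doubleton_eq_iff)
    then show ?thesis using Cons.IH[of x zs] D qs by blast
  qed
qed

lemma finite_threads: "finite (threads G v)"
proof -
  have "inj_on hd (threads G v)" using thread_eqI by (auto intro: inj_onI)
  moreover have "hd ` threads G v \<subseteq> nb v" using threads_nb(1) by blast
  ultimately show ?thesis using finite_nb inj_on_finite by blast
qed

lemma threads_disjoint:
  assumes "p \<in> threads G v" "q \<in> threads G v" "p \<noteq> q" shows "set p \<inter> set q = {}"
  using branch_disjoint[OF assms(1,2)[THEN threads_nb(1)]] thread_eqI[OF assms(1,2)] assms
  by (auto simp: set_thread)

lemma thread_out_degree: "vs \<in> threads G v \<Longrightarrow> u \<in> set vs \<Longrightarrow> out_degree G u \<le> 2"
  by (cases vs rule: rev_cases) (auto simp: threads_def)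

text \<open>The degrees keep each of \<open>v\<close>, \<open>w\<close> off the other's thread. From
  a common vertex \<open>u\<close>, the way to \<open>w\<close> would pass \<open>v\<close> and the
  way to \<open>v\<close> would pass \<open>w\<close>, forcing \<open>d v w = 0\<close>.\<close>

lemma threads_disjoint':
  assumes p: "p \<in> threads G v" and q: "q \<in> threads G w" and vw: "v \<noteq> w"
    and deg: "out_degree G v \<ge> 3" "out_degree G w \<ge> 3"
  shows "set p \<inter> set q = {}"
proof (rule ccontr)
  assume "set p \<inter> set q \<noteq> {}"
  then obtain u where u: "u \<in> branch v (hd p)" "u \<in> branch w (hd q)"
    using set_thread p q by auto
  have n: "w \<notin> branch v (hd p)" "v \<notin> branch w (hd q)"
    using deg thread_out_degree[OF p, of w] thread_out_degree[OF q, of v]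
      set_thread[OF p] set_thread[OF q] by fastforce+
  have V: "v \<in> verts G" "w \<in> verts G"
    using threads_nb(1)[OF p] threads_nb(1)[OF q] nb_verts by blast+
  have "d u w = d u v + d v w" "d u v = d u w + d w v"
    using dist_through_root[OF threads_nb(1)[OF p]] dist_through_root[OF threads_nb(1)[OF q]] u n V
    by blast+
  then show False using dist_0_iff[OF V] vw by simp
qed

text \<open>Every edge at a thread vertex is an edge of the thread; this supplies the arc condition
  when a graph is recognised as a path.\<close>

lemma thread_arcs:
  assumes "vs \<in> threads G v" "u \<in> set vs" "w \<in> nb u"
  shows "(u, w) \<in> set (vwalk_arcs (v # vs)) \<union> (set (vwalk_arcs (v # vs)))\<inverse>"
  using assms
proof (induction vs arbitrary: v)
  case Nil
  then show ?case by simp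
next
  case (Cons x ys)
  show ?case
  proof (cases "ys = []")
    case True
    then show ?thesis using Cons.prems singleton_thread_iff[of x v] by auto
  next
    case False
    note D = thread_ConsD[OF Cons.prems(1) False]
    show ?thesis
    proof (cases "u = x")
      case True
      then show ?thesis using False D Cons.prems(3) by auto
    next
      case False
      then show ?thesis using Cons.IH[OF D(4)] Cons.prems by auto
    qed
  qed
qed

section \<open>Root vertices inside branches\<close>

lemma root_verticesI:
  assumes v: "card (nb v) \<ge> 3" and pq: "p \<in> threads G v" "q \<in> threads G v" "p \<noteq> q"
  shows "v \<in> root_vertices G"
proof -
  have "card {p, q} \<le> card (threads G v)" using pq finite_threads by (intro card_mono) auto
  moreover have "v \<in> verts G" using threads_nb(1)[OF pq(1)] nb_verts by blast
  ultimately show ?thesis using v pq by (simp add: root_vertices_def root_degree_def out_degree_nb)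
qed

text \<open>Induction on the size of the branch. If no smaller branch at \<open>a\<close> supplies a
  root, all of them are threads at \<open>a\<close>: with at most one, \<open>a\<close> extends it
  to a thread at \<open>c\<close>; with two or more, \<open>a\<close> has degree at least 3 and is
  itself the root.\<close>

lemma thread_or_root:
  assumes "a \<in> nb c"
  shows "(\<exists>vs\<in>threads G c. hd vs = a) \<or>
    (\<exists>w p q. w \<in> root_vertices G \<and> w \<in> branch c a \<and> p \<in> threads G w \<and> q \<in> threads G w \<and>
      p \<noteq> q \<and> set p \<union> set q \<subseteq> branch c a)"
    (is "?T c a \<or> ?R c a")
  using assms
proof (induction "card (branch c a)" arbitrary: c a rule: less_induct)
  case less
  note a = less.prems
  have IH: "?T a b \<or> ?R c a" if b: "b \<in> nb a" "b \<noteq> c" for b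
  proof -
    have sub: "branch a b \<subset> branch c a" using branch_psubset a b by blast
    then have "card (branch a b) < card (branch c a)" using finite_branch by (intro psubset_card_mono)
    from less.hyps[OF this b(1)] sub show ?thesis by blast
  qed
  have c: "c \<in> nb a" using nb_sym[OF a] .
  consider "nb a = {c}" | b where "b \<noteq> c" "nb a = {c, b}"
    | b b' where "b \<in> nb a" "b' \<in> nb a" "b \<noteq> c" "b' \<noteq> c" "b \<noteq> b'" using c by blast
  then show ?case
  proof cases
    case 1
    then have "[a] \<in> threads G c" using a by (simp add: singleton_thread_iff)
    then show ?thesis by force
  next
    case (2 b)
    then consider vs where "vs \<in> threads G a" "hd vs = b" | "?R c a" using IH[of b] by blast
    then show ?thesis
    proof cases
      case (1 vs)
      then have "a # vs \<in> threads G c" using 2 a by (intro thread_ConsI) auto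
      then show ?thesis by force
    qed simp
  next
    case (3 b b')
    then consider p q where "p \<in> threads G a" "hd p = b" "q \<in> threads G a" "hd q = b'" | "?R c a"
      using IH[of b] IH[of b'] by blast
    then show ?thesis
    proof cases
      case (1 p q)
      have "card {c, b, b'} \<le> card (nb a)" using 3 c finite_nb by (intro card_mono) auto
      then have "a \<in> root_vertices G" using 1 3 by (intro root_verticesI[of a p q]) auto
      moreover have "set p \<union> set q \<subseteq> branch c a"
        using 1 3 set_thread branch_psubset[OF a] by blast
      moreover have "a \<in> branch c a" using branch_decomp[OF a] by blast
      ultimately show ?thesis using 1 3 by blast
    qed simp
  qed
qed

section \<open>Recognising path graphs\<close>

lemma is_path_graphI:
  assumes "vpath p G" "set p = verts G"
    and "\<And>u w. u \<in> verts G \<Longrightarrow> w \<in> nb u \<Longrightarrow> (u, w) \<in> set (vwalk_arcs p) \<union> (set (vwalk_arcs p))\<inverse>"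
  shows "is_path_graph G"
proof -
  have "arcs_ends G \<subseteq> set (vwalk_arcs p) \<union> (set (vwalk_arcs p))\<inverse>"
  proof
    fix e assume e: "e \<in> arcs_ends G"
    then show "e \<in> set (vwalk_arcs p) \<union> (set (vwalk_arcs p))\<inverse>"
      using assms(3)[of "fst e" "snd e"] adj_in_verts(1)[of "fst e" "snd e"] by (simp add: nb_def)
  qed
  moreover have "set (vwalk_arcs p) \<subseteq> arcs_ends G"
    using assms(1) by (simp add: vpath_def vwalk_def)
  ultimately have "arcs_ends G = set (vwalk_arcs p) \<union> (set (vwalk_arcs p))\<inverse>"
    using adj_sym by blast
  then show ?thesis using assms graph_axioms unfolding is_path_graph_def by blast
qed

lemma is_path_graph_no_nb: assumes "c \<in> verts G" "nb c = {}" shows "is_path_graph G"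
  using assms verts_decomp[OF assms(1)] by (intro is_path_graphI[of "[c]"]) (auto simp: vpath_def vwalk_def)

lemma is_path_graph_one_thread:
  assumes p: "p \<in> threads G c" and nb: "nb c = {hd p}" shows "is_path_graph G"
proof (rule is_path_graphI[of "c # p"])
  have c: "c \<in> verts G" using threads_nb(1)[OF p] nb_verts by blast
  show "vpath (c # p) G" using p by (simp add: threads_def)
  show vs: "set (c # p) = verts G" using verts_decomp[OF c] nb set_thread[OF p] by simp
  fix u w assume u: "u \<in> verts G" and w: "w \<in> nb u"
  then show "(u, w) \<in> set (vwalk_arcs (c # p)) \<union> (set (vwalk_arcs (c # p)))\<inverse>"
    using thread_arcs[OF p, of u w] vs nb threads_nb(2)[OF p] by (cases "u = c") auto
qed

lemma is_path_graph_two_threads: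
  assumes p: "p \<in> threads G c" and q: "q \<in> threads G c" and pq: "p \<noteq> q"
    and nb: "nb c = {hd p, hd q}"
  shows "is_path_graph G"
proof -
  have c: "c \<in> verts G" using threads_nb(1)[OF p] nb_verts by blast
  have ne: "p \<noteq> []" "q \<noteq> []" using threads_nb p q by auto
  \<comment> \<open>The path runs from the far end of \<open>p\<close> through \<open>c\<close> to
    the far end of \<open>q\<close>. Its first part uses the arcs of \<open>p\<close> backwards,
    which the symmetric closure absorbs.\<close>
  define xs where "xs = rev p @ c # q"
  have arcs: "set (vwalk_arcs xs) = (set (vwalk_arcs (c # p)))\<inverse> \<union> set (vwalk_arcs (c # q))"
  proof -
    have "set (vwalk_arcs xs) = set (vwalk_arcs (rev p)) \<union> {(hd p, c)} \<union> set (vwalk_arcs (c # q))"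
      unfolding xs_def using ne by (subst vwalk_arcs_append) (auto simp: last_rev)
    then show ?thesis using ne by (auto simp: set_vwalk_arcs_rev)
  qed
  have vs: "set xs = verts G"
    using verts_decomp[OF c] nb set_thread[OF p] set_thread[OF q] by (auto simp: xs_def)
  show ?thesis
  proof (rule is_path_graphI[OF _ vs])
    have "set (vwalk_arcs (c # p)) \<subseteq> arcs_ends G" "set (vwalk_arcs (c # q)) \<subseteq> arcs_ends G"
      using p q by (auto simp: threads_def vpath_def vwalk_def)
    moreover have "distinct xs"
      using threads_nb[OF p] threads_nb[OF q] threads_disjoint[OF p q pq] by (auto simp: xs_def)
    ultimately show "vpath xs G"
      using vs arcs adj_sym by (auto simp: vpath_def vwalk_def xs_def)
    fix u w assume u: "u \<in> verts G" and w: "w \<in> nb u"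
    then consider "u \<in> set p" | "u \<in> set q" | "u = c" using vs by (auto simp: xs_def)
    then show "(u, w) \<in> set (vwalk_arcs xs) \<union> (set (vwalk_arcs xs))\<inverse>"
    proof cases
      case 1
      then show ?thesis using thread_arcs[OF p 1 w] arcs by auto
    next
      case 2
      then show ?thesis using thread_arcs[OF q 2 w] arcs by auto
    next
      case 3
      then show ?thesis using w nb ne arcs by auto
    qed
  qed
qed

section \<open>Trees that are not paths\<close>

lemma ex_short_threads:
  assumes np: "\<not> is_path_graph G" and a: "a \<in> nb c" and b: "b \<in> nb c" and ab: "a \<noteq> b"
  obtains w p q where "w \<in> root_vertices G" "p \<in> threads G w" "q \<in> threads G w" "p \<noteq> q"
    "length p + length q \<le> card (branch c a) + card (branch c b)"
proof -
  have bound: "length p + length q \<le> card (branch c a) + card (branch c b)"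
    if "p \<in> threads G w" "q \<in> threads G w" "p \<noteq> q" "set p \<union> set q \<subseteq> branch c a \<union> branch c b" for w p q
  proof -
    have "length p + length q = card (set p \<union> set q)"
      using that threads_disjoint threads_nb(3) by (simp add: card_Un_disjoint distinct_card)
    also have "\<dots> \<le> card (branch c a \<union> branch c b)"
      using that(4) finite_branch by (intro card_mono) auto
    also have "\<dots> \<le> card (branch c a) + card (branch c b)" by (rule card_Un_le)
    finally show ?thesis .
  qed
  have "\<exists>w p q. w \<in> root_vertices G \<and> p \<in> threads G w \<and> q \<in> threads G w \<and> p \<noteq> q \<and>
    set p \<union> set q \<subseteq> branch c a \<union> branch c b"
  proof (cases "(\<exists>p\<in>threads G c. hd p = a) \<and> (\<exists>q\<in>threads G c. hd q = b)")
    case True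
    then obtain p q where pq: "p \<in> threads G c" "hd p = a" "q \<in> threads G c" "hd q = b" by blast
    \<comment> \<open>If both branches are threads, a third neighbour must exist, since otherwise
      the graph is a path; this makes \<open>c\<close> a root.\<close>
    have "nb c \<noteq> {a, b}" using is_path_graph_two_threads[of p c q] pq ab np by auto
    then obtain e where e: "e \<in> nb c" "e \<noteq> a" "e \<noteq> b" using a b by blast
    then have "card {a, b, e} \<le> card (nb c)" using a b finite_nb by (intro card_mono) auto
    then have "card (nb c) \<ge> 3" using e ab by auto
    then have "c \<in> root_vertices G" using root_verticesI[of c p q] pq ab by auto
    moreover have "set p \<union> set q \<subseteq> branch c a \<union> branch c b" using set_thread pq by blast
    ultimately show ?thesis using pq ab by blast
  next
    case False
    \<comment> \<open>A branch that is not a thread at \<open>c\<close> already contains two threads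
      of one root.\<close>
    then show ?thesis using thread_or_root[OF a] thread_or_root[OF b] by blast
  qed
  then show thesis using bound that by blast
qed

lemma root_vertices_nonempty: assumes np: "\<not> is_path_graph G" shows "root_vertices G \<noteq> {}"
proof -
  obtain c where c: "c \<in> verts G"
    using conn unfolding connected_def strongly_connected_def by auto
  then obtain a where a: "a \<in> nb c" using is_path_graph_no_nb np by blast
  show ?thesis
  proof (cases "nb c = {a}")
    case True
    then show ?thesis using thread_or_root[OF a] is_path_graph_one_thread[of _ c] np by blast
  next
    case False
    then obtain b where "b \<in> nb c" "b \<noteq> a" using a by blast
    then show ?thesis using ex_short_threads[OF np a, of b] by blast
  qed
qed

section \<open>\<open>kappa_star\<close> as a minimum over pairs of threads\<close>

lemma root_vertexD:
  assumes "v \<in> root_vertices G"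
  shows "v \<in> verts G" "card (nb v) \<ge> 3" "card (threads G v) \<ge> 2"
  using assms by (auto simp: root_vertices_def root_degree_def out_degree_nb)

lemma two_shortest_threads:
  assumes v: "v \<in> root_vertices G"
  obtains p q where "p \<in> threads G v" "q \<in> threads G v" "p \<noteq> q"
    "thread_lengths G v ! 0 = length p" "thread_lengths G v ! 1 = length q"
  using sorted_image_two_least(1)[OF finite_threads root_vertexD(3)[OF v], of length] that
  unfolding thread_lengths_def by metis

lemma finite_root_vertices: "finite (root_vertices G)"
  by (rule finite_subset[of _ "verts G"]) (auto simp: root_vertices_def)

lemma kappa_star_le:
  assumes v: "v \<in> root_vertices G" and pq: "p \<in> threads G v" "q \<in> threads G v" "p \<noteq> q"
  shows "kappa_star G \<le> 2 * (length p + length q)"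
proof -
  have "kappa_star G \<le> 2 * (thread_lengths G v ! 0 + thread_lengths G v ! 1)"
    unfolding kappa_star_def using v finite_root_vertices by (intro Min_le) auto
  also have "\<dots> \<le> 2 * (length p + length q)"
    using sorted_image_two_least(2)[OF finite_threads root_vertexD(3)[OF v] pq, of length]
    unfolding thread_lengths_def by simp
  finally show ?thesis .
qed

lemma kappa_star_attained:
  assumes "root_vertices G \<noteq> {}"
  obtains v p q where "v \<in> root_vertices G" "p \<in> threads G v" "q \<in> threads G v" "p \<noteq> q"
    "kappa_star G = 2 * (length p + length q)"
proof -
  let ?S = "{2 * (thread_lengths G v ! 0 + thread_lengths G v ! 1) | v. v \<in> root_vertices G}"
  have "Min ?S \<in> ?S" using assms finite_root_vertices by (intro Min_in) auto
  then obtain v where v: "v \<in> root_vertices G"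
    "kappa_star G = 2 * (thread_lengths G v ! 0 + thread_lengths G v ! 1)"
    unfolding kappa_star_def by blast
  then show thesis using two_shortest_threads[OF v(1)] that by metis
qed

section \<open>Bounds and exact values for \<open>Delta_set\<close>\<close>

text \<open>The way from \<open>y\<close> to \<open>s\<close> passes \<open>c\<close> and then
  \<open>a\<close>, while \<open>x\<close> reaches \<open>s\<close> without going beyond
  \<open>a\<close>; with \<open>c\<close> equidistant, this saves the edge between \<open>a\<close>
  and \<open>c\<close> twice.\<close>

lemma Delta_vertex_ge_2:
  assumes a: "a \<in> nb c" and b: "b \<in> nb c" and ab: "a \<noteq> b"
    and x: "x \<in> branch c a" and y: "y \<in> branch c b" and m: "d x c = d y c" and s: "s \<in> branch c a"
  shows "Delta_vertex G s x y \<ge> 2"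
proof -
  have V: "x \<in> verts G" "s \<in> verts G" "a \<in> verts G" "c \<in> verts G"
    using x s nb_verts[OF a] by (auto simp: branch_def)
  have "s \<notin> branch c b" using branch_disjoint[OF a b ab] s by blast
  then have "d y s = d y c + d c s" using dist_through_root[OF b y V(2)] by blast
  moreover have "d x s \<le> d x a + d a s" using dist_triangle V by blast
  moreover have "d c s = d a s + 1" "d x c = d x a + 1"
    using dist_in_branch[OF a s] dist_in_branch[OF a x] V dist_sym by metis+
  ultimately show ?thesis using m by (simp add: Delta_vertex_def)
qed

lemma Delta_set_ge_min:
  assumes np: "\<not> is_path_graph G" and x: "x \<in> verts G" and y: "y \<in> verts G" and xy: "x \<noteq> y"
  shows "min (card (verts G)) (kappa_star G) \<le> Delta_set G (verts G) x y"
proof (cases "even (d x y)")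
  case False
  have "1 \<le> Delta_vertex G s x y" if "s \<in> verts G" for s
  proof -
    have "d x s \<noteq> d y s" using parity[OF x y that] False by auto
    then show ?thesis by (simp add: Delta_vertex_def)
  qed
  then have "(\<Sum>s\<in>verts G. 1) \<le> Delta_set G (verts G) x y"
    unfolding Delta_set_def by (intro sum_mono)
  then show ?thesis by simp
next
  case True
  then obtain m where m: "d x y = 2 * m" by blast
  obtain c where c: "c \<in> verts G" "d x c = m" "d c y = d x y - m"
    using geodesic_split[OF x y, of m] m by auto
  have mpos: "m > 0" using m xy dist_0_iff[OF x y] by simp
  have dc: "d c x = m" "d c y = m" using c m dist_sym[OF x] by auto
  have "c \<noteq> x" "c \<noteq> y" using dc mpos x y by auto
  obtain a where a: "a \<in> nb c" "d c x = d a x + 1" using ex_closer_nb[OF c(1) x \<open>c \<noteq> x\<close>] .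
  obtain b where b: "b \<in> nb c" "d c y = d b y + 1" using ex_closer_nb[OF c(1) y \<open>c \<noteq> y\<close>] .
  \<comment> \<open>If \<open>a = b\<close>, this bound would be \<open>2 * m - 2\<close>, below
    \<open>d x y\<close>.\<close>
  have "d x y \<le> d a x + d a y" using dist_triangle[OF x _ y, of a] dist_sym[OF x] nb_verts[OF a(1)] by simp
  then have ab: "a \<noteq> b" using a b dc m by auto
  have br: "x \<in> branch c a" "y \<in> branch c b" using a b x y by (auto simp: branch_def)
  have dm: "d x c = d y c" using dc dist_sym[OF c(1)] x y by simp
  let ?U = "branch c a \<union> branch c b"
  have ge2: "2 \<le> Delta_vertex G s x y" if "s \<in> ?U" for s
  proof (cases "s \<in> branch c a")
    case True
    then show ?thesis using Delta_vertex_ge_2 a b ab br dm by blast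
  next
    case False
    then have "2 \<le> Delta_vertex G s y x"
      using Delta_vertex_ge_2[OF b(1) a(1) ab[symmetric] br(2,1) dm[symmetric]] that by blast
    then show ?thesis by (simp add: Delta_vertex_def abs_minus_commute)
  qed
  obtain w p q where w: "w \<in> root_vertices G" "p \<in> threads G w" "q \<in> threads G w" "p \<noteq> q"
    "length p + length q \<le> card (branch c a) + card (branch c b)"
    using ex_short_threads[OF np a(1) b(1) ab] .
  have "kappa_star G \<le> 2 * (length p + length q)" using kappa_star_le w by blast
  also have "\<dots> \<le> 2 * card ?U"
    using w(5) branch_disjoint[OF a(1) b(1) ab] finite_branch by (simp add: card_Un_disjoint)
  also have "\<dots> = (\<Sum>s\<in>?U. 2)" by simp
  also have "\<dots> \<le> (\<Sum>s\<in>?U. Delta_vertex G s x y)" using ge2 by (intro sum_mono)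
  also have "\<dots> \<le> Delta_set G (verts G) x y"
    unfolding Delta_set_def using branch_subset by (intro sum_mono2) auto
  finally show ?thesis by simp
qed

lemma Delta_set_nb: assumes a: "a \<in> nb c" shows "Delta_set G (verts G) c a = card (verts G)"
proof -
  have "Delta_vertex G s c a = 1" if "s \<in> verts G" for s
  proof (cases "s \<in> branch c a")
    case True
    then show ?thesis using dist_in_branch[OF a True] by (simp add: Delta_vertex_def)
  next
    case False
    then show ?thesis using dist_notin_branch[OF a that] by (simp add: Delta_vertex_def)
  qed
  then show ?thesis by (simp add: Delta_set_def)
qed

text \<open>A vertex in one of the two branches contributes 2; every other vertex is equidistant
  from \<open>a\<close> and \<open>b\<close>.\<close>

lemma Delta_set_common_nb:
  assumes a: "a \<in> nb c" and b: "b \<in> nb c" and ab: "a \<noteq> b"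
  shows "Delta_set G (verts G) a b = 2 * (card (branch c a) + card (branch c b))"
proof -
  let ?U = "branch c a \<union> branch c b"
  have dis: "branch c a \<inter> branch c b = {}" using branch_disjoint a b ab .
  have D: "Delta_vertex G s a b = (if s \<in> ?U then 2 else 0)" if "s \<in> verts G" for s
  proof -
    consider "s \<in> branch c a" "s \<notin> branch c b" | "s \<notin> branch c a" "s \<in> branch c b"
      | "s \<notin> branch c a" "s \<notin> branch c b" using dis by blast
    then show ?thesis
    proof cases
      case 1
      then show ?thesis using dist_in_branch[OF a 1(1)] dist_notin_branch[OF b that 1(2)]
        by (simp add: Delta_vertex_def)
    next
      case 2
      then show ?thesis using dist_in_branch[OF b 2(2)] dist_notin_branch[OF a that 2(1)]
        by (simp add: Delta_vertex_def)
    next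
      case 3
      then show ?thesis using dist_notin_branch[OF a that 3(1)] dist_notin_branch[OF b that 3(2)]
        by (simp add: Delta_vertex_def)
    qed
  qed
  have "Delta_set G (verts G) a b = (\<Sum>s\<in>verts G. if s \<in> ?U then 2 else 0)"
    unfolding Delta_set_def using D by (intro sum.cong refl)
  also have "\<dots> = (\<Sum>s\<in>verts G \<inter> ?U. 2)" by (rule sum.inter_restrict[symmetric]) simp
  also have "verts G \<inter> ?U = ?U" using branch_subset by blast
  finally show ?thesis using dis finite_branch by (simp add: card_Un_disjoint)
qed

section \<open>The value of \<open>kappa\<close>\<close>

lemma weak_resolving_le:
  assumes S: "weak_resolving_set G k S" and x: "x \<in> verts G" "y \<in> verts G" "x \<noteq> y"
  shows "k \<le> Delta_set G (verts G) x y"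
proof -
  have "k \<le> Delta_set G S x y" using S x by (simp add: weak_resolving_set_def)
  also have "\<dots> \<le> Delta_set G (verts G) x y"
    unfolding Delta_set_def using S by (intro sum_mono2) (auto simp: weak_resolving_set_def)
  finally show ?thesis .
qed

lemma kappa_eq:
  assumes np: "\<not> is_path_graph G"
  shows "kappa G = min (card (verts G)) (kappa_star G)"
  unfolding kappa_def
proof (rule Greatest_equality)
  obtain v p q where v: "v \<in> root_vertices G" "p \<in> threads G v" "q \<in> threads G v" "p \<noteq> q"
    and ks: "kappa_star G = 2 * (length p + length q)"
    using kappa_star_attained[OF root_vertices_nonempty[OF np]] .
  have p: "hd p \<in> nb v" "p \<noteq> []" and q: "hd q \<in> nb v" using threads_nb v by auto
  have hd: "hd p \<noteq> hd q" using thread_eqI v by blast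
  have "1 \<le> card (verts G)" using root_vertexD(1)[OF v(1)] by (auto simp: Suc_le_eq card_gt_0_iff)
  moreover have "1 \<le> kappa_star G" using ks p(2) by (cases p) auto
  moreover have "weak_resolving_set G (min (card (verts G)) (kappa_star G)) (verts G)"
    using Delta_set_ge_min[OF np] by (simp add: weak_resolving_set_def)
  ultimately show "1 \<le> min (card (verts G)) (kappa_star G) \<and>
    (\<exists>S. weak_resolving_set G (min (card (verts G)) (kappa_star G)) S)" by auto
  fix k assume "1 \<le> k \<and> (\<exists>S. weak_resolving_set G k S)"
  then obtain S where S: "weak_resolving_set G k S" by blast
  \<comment> \<open>Two test pairs give the upper bound: an edge at \<open>v\<close> yields the
    number of vertices, and the first vertices of a minimising pair of threads yield
    \<open>kappa_star G\<close>.\<close>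
  have "k \<le> Delta_set G (verts G) v (hd p)"
    using weak_resolving_le[OF S] nb_verts[OF p(1)] nb_irrefl[OF p(1)] by blast
  moreover have "k \<le> Delta_set G (verts G) (hd p) (hd q)"
    using weak_resolving_le[OF S] nb_verts[OF p(1)] nb_verts[OF q] hd by blast
  ultimately show "k \<le> min (card (verts G)) (kappa_star G)"
    using Delta_set_nb[OF p(1)] Delta_set_common_nb[OF p(1) q hd] ks length_thread v by simp
qed

section \<open>Comparing \<open>kappa_star\<close> with the number of vertices\<close>

lemma sum_length_threads_le:
  assumes F: "finite F" and disj: "pairwise (\<lambda>p q. set p \<inter> set q = {}) F"
    and th: "\<And>p. p \<in> F \<Longrightarrow> \<exists>v. p \<in> threads G v"
  shows "sum length F \<le> card (verts G)"
proof -
  have "length p = card (set p)" if "p \<in> F" for p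
    using th[OF that] threads_nb(3) distinct_card[of p] by auto
  then have "sum length F = (\<Sum>p\<in>F. card (set p))" by (intro sum.cong refl)
  also have "\<dots> = card (\<Union>p\<in>F. set p)"
    using F disj by (subst card_UN_disjoint) (auto simp: pairwise_def)
  also have "\<dots> \<le> card (verts G)"
    using th set_thread branch_subset by (intro card_mono UN_least) (simp, metis)
  finally show ?thesis .
qed

lemma kappa_star_le_card:
  assumes np: "\<not> is_path_graph G" and S3: "\<nexists>l1 l2 l3. is_S3 G l1 l2 l3"
  shows "kappa_star G \<le> card (verts G)"
proof -
  \<comment> \<open>To be applied to two pairs of threads, all four disjoint: the shorter pair
    covers at most half of the vertices.\<close>
  have half: "k \<le> m" if "i + j \<le> m" "k \<le> 2 * i" "k \<le> 2 * j" for i j k m :: nat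
    using that by linarith
  obtain v where v: "v \<in> root_vertices G" using root_vertices_nonempty[OF np] by blast
  obtain p q where pq: "p \<in> threads G v" "q \<in> threads G v" "p \<noteq> q" using two_shortest_threads[OF v] .
  show ?thesis
  proof (cases "root_vertices G = {v}")
    case False
    then obtain w where w: "w \<in> root_vertices G" "v \<noteq> w" using v by blast
    obtain p' q' where pq': "p' \<in> threads G w" "q' \<in> threads G w" "p' \<noteq> q'"
      using two_shortest_threads[OF w(1)] .
    have cross: "set r \<inter> set t = {}" if "r \<in> threads G v" "t \<in> threads G w" for r t
      using threads_disjoint'[OF that w(2)] root_vertexD(2)[OF v] root_vertexD(2)[OF w(1)]
      by (simp add: out_degree_nb)
    \<comment> \<open>Distinctness keeps the sum over the set of four threads from merging
      terms.\<close>
    have ne: "r \<noteq> t" if "r \<in> threads G v" "t \<in> threads G w" for r t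
      using cross[OF that] threads_nb(2)[OF that(1)] by (cases r) auto
    have "sum length {p, q, p', q'} \<le> card (verts G)"
    proof (rule sum_length_threads_le)
      show "pairwise (\<lambda>p q. set p \<inter> set q = {}) {p, q, p', q'}"
        using cross pq pq' threads_disjoint[OF pq] threads_disjoint[OF pq']
        by (auto simp: pairwise_insert Int_commute)
    qed (use pq pq' in auto)
    then have "length p + length q + (length p' + length q') \<le> card (verts G)"
      using pq pq' ne by simp
    then show ?thesis using kappa_star_le[OF v pq] kappa_star_le[OF w(1) pq'] by (rule half)
  next
    case True
    \<comment> \<open>The only root is \<open>v\<close>, which lies in none of its own branches, so
      every branch at \<open>v\<close> is a thread.\<close>
    have "nb v \<subseteq> hd ` threads G v"
    proof
      fix a assume "a \<in> nb v"
      from thread_or_root[OF this] show "a \<in> hd ` threads G v"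
        unfolding True by (auto simp: root_notin_branch)
    qed
    then have "card (nb v) \<le> card (threads G v)" using finite_threads surj_card_le by blast
    then have ge3: "card (threads G v) \<ge> 3" using root_vertexD(2)[OF v] by simp
    moreover have "card (threads G v) \<noteq> 3"
    proof
      assume c3: "card (threads G v) = 3"
      then have "length (thread_lengths G v) = 3"
        using size_mset[of "thread_lengths G v"] by (simp add: thread_lengths_def)
      then obtain l1 l2 l3 where "thread_lengths G v = [l1, l2, l3]"
        by (auto simp: length_Suc_conv numeral_3_eq_3)
      moreover have "is_tree G"
        using graph_axioms conn acyclic unfolding is_tree_def by (meson not_less)
      ultimately show False using S3 True c3 by (auto simp: is_S3_def root_degree_def)
    qed
    ultimately have "4 \<le> card (threads G v)" by linarith
    then obtain F where F: "F \<subseteq> threads G v" "card F = 4" "finite F"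
      using obtain_subset_with_card_n by metis
    then obtain p1 p2 p3 p4 where F4: "F = {p1, p2, p3, p4}" "distinct [p1, p2, p3, p4]"
      by (auto simp: card_Suc_eq numeral_eq_Suc)
    have "pairwise (\<lambda>p q. set p \<inter> set q = {}) F"
      unfolding pairwise_def using F(1) threads_disjoint by blast
    then have "sum length F \<le> card (verts G)"
      using F by (intro sum_length_threads_le) auto
    then have "length p1 + length p2 + (length p3 + length p4) \<le> card (verts G)"
      using F4 by simp
    moreover have "kappa_star G \<le> 2 * (length p1 + length p2)" "kappa_star G \<le> 2 * (length p3 + length p4)"
      using F F4 kappa_star_le[OF v, of p1 p2] kappa_star_le[OF v, of p3 p4] by simp_all
    ultimately show ?thesis by (rule half)
  qed
qed

end

theorem theorem3p1:
  fixes T :: "('a, 'b) pre_digraph" and n :: nat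
  assumes "is_tree T" and "card (verts T) = n" and "\<not> is_path_graph T"
  shows "kappa T = min n (kappa_star T) \<and>
    ((\<nexists>l1 l2 l3. is_S3 T l1 l2 l3) \<longrightarrow> kappa T = kappa_star T)"
proof -
  interpret graph T using assms(1) by (simp add: is_tree_def)
  interpret tree_graph T
    using assms(1) by unfold_locales (auto simp: is_tree_def not_less)
  show ?thesis
    using kappa_eq[OF assms(3)] kappa_star_le_card[OF assms(3)] assms(2) by auto
qed

end
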